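(* Let $F$ be a finite field, $\Gamma$ a nonempty set, $\varphi:\Gamma\to\Gamma$ a self-map, $\mathfrak{w}=(\mathfrak{w}_\alpha)_{\alpha\in\Gamma}\in F^\Gamma$, and let $\sigma_{\varphi,\mathfrak{w}}:F^\Gamma\to F^\Gamma$, $\sigma_{\varphi,\mathfrak{w}}((x_\alpha)_{\alpha\in\Gamma})=(\mathfrak{w}_\alpha x_{\varphi(\alpha)})_{\alpha\in\Gamma}$. Suppose $\sigma_{\varphi,\mathfrak{w}}(\bigoplus_{\Gamma}F)\subseteq\bigoplus_{\Gamma}F$. Then $\sigma_{\varphi,\mathfrak{w}}\restriction_{\bigoplus_{\Gamma}F}:\bigoplus_{\Gamma}F\to\bigoplus_{\Gamma}F$ is of finite fibre if and only if $\sigma_{\varphi,\mathfrak{w}}:F^\Gamma\to F^\Gamma$ is of finite fibre.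
   Context: $\bigoplus_\Gamma F=\{(x_\alpha)_{\alpha\in\Gamma}\in F^\Gamma:\{\alpha:x_\alpha\neq0\}\text{ is finite}\}$. A map $f:A\to B$ is of finite fibre if $f^{-1}(y)$ is finite for all $y\in B$. *)

theory Defs
  imports Main
begin

definition direct_sum :: "('g \<Rightarrow> 'f::zero) set" where
  "direct_sum = {x. finite {\<alpha>. x \<alpha> \<noteq> 0}}"

definition weighted_shift :: "('g \<Rightarrow> 'g) \<Rightarrow> ('g \<Rightarrow> 'f::times) \<Rightarrow> ('g \<Rightarrow> 'f) \<Rightarrow> ('g \<Rightarrow> 'f)" where
  "weighted_shift \<phi> w x = (\<lambda>\<alpha>. w \<alpha> * x (\<phi> \<alpha>))"

(* The fibres are taken inside A, so "finite_fibre f A B" speaks about the restriction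
   of f to A; that f maps A into B is part of the predicate. *)
definition finite_fibre :: "('a \<Rightarrow> 'b) \<Rightarrow> 'a set \<Rightarrow> 'b set \<Rightarrow> bool" where
  "finite_fibre f A B \<longleftrightarrow> f ` A \<subseteq> B \<and> (\<forall>y\<in>B. finite {x \<in> A. f x = y})"

end

theory Submission
  imports Defs
begin

text \<open>Two functions have the same image under the weighted shift iff they agree on
  \<open>\<phi> ` {\<alpha>. w \<alpha> \<noteq> 0}\<close>. Hence every nonempty fibre is a copy of the functions supported on the
  complement of that set, and, \<open>F\<close> being finite, either kind of fibre is finite as soon as this
  complement is finite. Conversely, the unit vectors at points of the complement are
  infinitely many finitely supported elements of the kernel if the complement is infinite.\<close>

text \<open>Where \<open>w \<alpha> = 0\<close> both images vanish at \<alpha>; elsewhere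
  \<open>w \<alpha>\<close> cancels, as an integral domain has no zero divisors.\<close>

lemma weighted_shift_eq_iff:
  fixes w :: "'g \<Rightarrow> 'f::idom"
  shows "weighted_shift \<phi> w x = weighted_shift \<phi> w y
    \<longleftrightarrow> (\<forall>\<beta>\<in>\<phi> ` {\<alpha>. w \<alpha> \<noteq> 0}. x \<beta> = y \<beta>)"
  by (auto simp: weighted_shift_def fun_eq_iff)

lemma finite_weighted_shift_fibre:
  fixes w :: "'g \<Rightarrow> 'f::{idom,finite}"
  assumes "finite (- \<phi> ` {\<alpha>. w \<alpha> \<noteq> 0})"
  shows "finite {x. weighted_shift \<phi> w x = y}"
proof (cases "\<exists>x. weighted_shift \<phi> w x = y")
  case True
  then obtain x0 where x0: "weighted_shift \<phi> w x0 = y" ..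
  let ?S = "- \<phi> ` {\<alpha>. w \<alpha> \<noteq> 0}"
  \<comment> \<open>Subtracting a fixed fibre element turns agreement with \<open>x0\<close> off
    \<open>?S\<close> into vanishing there, the default value that
    \<open>finite_set_of_finite_funs\<close> expects.\<close>
  let ?d = "\<lambda>x \<beta>. x \<beta> - x0 \<beta>"
  have "finite {f :: 'g \<Rightarrow> 'f. \<forall>\<beta>. (\<beta> \<in> ?S \<longrightarrow> f \<beta> \<in> UNIV) \<and> (\<beta> \<notin> ?S \<longrightarrow> f \<beta> = 0)}"
    using assms by (intro finite_set_of_finite_funs) auto
  moreover have "?d ` {x. weighted_shift \<phi> w x = y}
      \<subseteq> {f. \<forall>\<beta>. (\<beta> \<in> ?S \<longrightarrow> f \<beta> \<in> UNIV) \<and> (\<beta> \<notin> ?S \<longrightarrow> f \<beta> = 0)}"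
    unfolding x0[symmetric] weighted_shift_eq_iff by auto
  ultimately have "finite (?d ` {x. weighted_shift \<phi> w x = y})"
    by (rule rev_finite_subset)
  moreover have "inj_on ?d {x. weighted_shift \<phi> w x = y}"
    by (auto simp: inj_on_def fun_eq_iff)
  ultimately show ?thesis
    by (rule finite_imageD)
qed simp

lemma finite_compl_if_finite_kernel:
  fixes w :: "'g \<Rightarrow> 'f::idom"
  assumes "finite {x \<in> direct_sum. weighted_shift \<phi> w x = (\<lambda>_. 0)}"
  shows "finite (- \<phi> ` {\<alpha>. w \<alpha> \<noteq> 0})"
proof -
  let ?e = "\<lambda>\<beta> \<gamma>. if \<gamma> = \<beta> then 1 else 0 :: 'f"
  \<comment> \<open>If \<beta> is outside the image, every \<alpha> with
    \<open>\<phi> \<alpha> = \<beta>\<close> has weight 0, so the shift kills the unit vector at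
    \<beta>.\<close>
  have "?e ` (- \<phi> ` {\<alpha>. w \<alpha> \<noteq> 0})
      \<subseteq> {x \<in> direct_sum. weighted_shift \<phi> w x = (\<lambda>_. 0)}"
    by (auto simp: direct_sum_def weighted_shift_def fun_eq_iff split: if_splits)
  then have "finite (?e ` (- \<phi> ` {\<alpha>. w \<alpha> \<noteq> 0}))"
    using assms by (rule finite_subset)
  moreover have "inj_on ?e (- \<phi> ` {\<alpha>. w \<alpha> \<noteq> 0})"
    by (auto simp: inj_on_def fun_eq_iff split: if_splits)
  ultimately show ?thesis
    by (rule finite_imageD)
qed

theorem proposition7p1:
  fixes \<phi> :: "'g \<Rightarrow> 'g"
    and w :: "'g \<Rightarrow> 'f::{field,finite}"
  assumes "weighted_shift \<phi> w ` direct_sum \<subseteq> direct_sum"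
  shows "finite_fibre (weighted_shift \<phi> w) direct_sum direct_sum
     \<longleftrightarrow> finite_fibre (weighted_shift \<phi> w) UNIV UNIV"
proof
  assume "finite_fibre (weighted_shift \<phi> w) direct_sum direct_sum"
  moreover have "(\<lambda>_. 0) \<in> direct_sum"
    by (simp add: direct_sum_def)
  \<comment> \<open>The zero function lies in \<open>direct_sum\<close>, so the kernel is one of the
    fibres assumed finite.\<close>
  ultimately have "finite (- \<phi> ` {\<alpha>. w \<alpha> \<noteq> 0})"
    unfolding finite_fibre_def by (intro finite_compl_if_finite_kernel) blast
  then show "finite_fibre (weighted_shift \<phi> w) UNIV UNIV"
    by (simp add: finite_fibre_def finite_weighted_shift_fibre)
next
  assume "finite_fibre (weighted_shift \<phi> w) UNIV UNIV"
  then show "finite_fibre (weighted_shift \<phi> w) direct_sum direct_sum"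
    \<comment> \<open>Restricted fibres are subsets of full ones; \<open>assms\<close> supplies the
      inclusion of the image.\<close>
    using assms by (simp add: finite_fibre_def)
qed

end
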